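(* Let $\upsilon$ be the uniform distribution on $\mathcal{W}_n$ and let $T_\upsilon(n)=\sum_{w\in\mathcal{W}_n}\upsilon(w)\,\mathbb{E}(T\mid w_0=w)$ be the uniformly-weighted expected convergence time of the cooling process. Then $T_\upsilon(n)=O(n^{5/2}\ln n)$.
   Context: A configuration of length $n$ is a word $w=w_1\cdots w_n$ over $\{1,2\}$ with $|w|_1=|w|_2$; $\mathcal{W}_n$ is the set of such words. A flip at position $1\le i<n$ exchanges $w_i$ and $w_{i+1}$ when $w_i\ne w_{i+1}$. $E(w)$ is the number of indices $i$ with $w_i=w_{i+1}$ (mismatches). The cooling process is the Markov chain $(w_t)_{t\ge0}$ on $\mathcal{W}_n$ started at $w_0$, with $w_{t+1}=w_t$ if $E(w_t)=0$, and otherwise $w_{t+1}$ obtained by performing a flip chosen uniformly at random among the flips on $w_t$ that do not increase $E$. The convergence time is $T=\min\{t\ge0: E(w_t)=0\}$. *)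

theory Defs
  imports "HOL-Probability.Probability_Mass_Function"
begin

text \<open>Words over the alphabet {1,2} are nat lists; positions are 0-based.\<close>

definition configs :: "nat \<Rightarrow> nat list set" where
  "configs n = {w. length w = n \<and> set w \<subseteq> {1, 2} \<and>
                   length (filter (\<lambda>a. a = 1) w) = length (filter (\<lambda>a. a = 2) w)}"

definition mism :: "nat list \<Rightarrow> nat" where
  "mism w = card {i. Suc i < length w \<and> w ! i = w ! Suc i}"

definition flip :: "nat list \<Rightarrow> nat \<Rightarrow> nat list" where
  "flip w i = w[i := w ! Suc i, Suc i := w ! i]"

definition allowed_flips :: "nat list \<Rightarrow> nat set" where
  "allowed_flips w = {i. Suc i < length w \<and> w ! i \<noteq> w ! Suc i \<and> mism (flip w i) \<le> mism w}"

definition cool_step :: "nat list \<Rightarrow> nat list pmf" where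
  "cool_step w = (if mism w = 0 then return_pmf w
                  else map_pmf (flip w) (pmf_of_set (allowed_flips w)))"

fun cool_traj :: "nat \<Rightarrow> nat list \<Rightarrow> nat list list pmf" where
  "cool_traj 0 w = return_pmf [w]"
| "cool_traj (Suc t) w =
     bind_pmf (cool_traj t w) (\<lambda>xs. map_pmf (\<lambda>y. xs @ [y]) (cool_step (last xs)))"

text \<open>E(T | w_0 = w) with T = min{t. E(w_t) = 0}, computed as \<Sum>_t P(T > t)
  (value in ennreal, possibly \<infinity>); T > t iff E(w_s) \<noteq> 0 for all s \<le> t.\<close>
definition exp_conv_time :: "nat list \<Rightarrow> ennreal" where
  "exp_conv_time w =
     (\<Sum>t. ennreal (measure_pmf.prob (cool_traj t w) {xs. \<forall>x\<in>set xs. mism x \<noteq> 0}))"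

definition T_unif :: "nat \<Rightarrow> ennreal" where
  "T_unif n = (\<Sum>w\<in>configs n. exp_conv_time w) / of_nat (card (configs n))"

end

theory Submission
  imports Defs
begin

text \<open>
  Read the letters 1 and 2 as steps +1 and -1, so that a configuration of length \<open>n\<close> becomes a
  bridge \<open>h\<close> with \<open>h 0 = h n = 0\<close>, and a flip changes a single height by 2. The process is
  controlled by the Lyapunov function
  \<open>\<Sum>i,j. \<bar>h i - h j\<bar> + 2 n (\<Sum>i. \<bar>h i\<bar>) + 4 n E\<close>.
  With \<open>U v = (\<Sum>j. \<bar>v - h j\<bar>) + n \<bar>v\<bar>\<close>, moving \<open>h k\<close> from \<open>v\<close> to \<open>v'\<close> changes the first two terms by
  \<open>2 (U v' - U v) - 4\<close>; the \<open>- 4\<close> comes from the diagonal pair \<open>(k, k)\<close>, which \<open>U\<close> counts but the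
  double sum does not. Viewing mismatches as particles that hop by two sites and exclude each other, a
  summation by parts and the convexity of \<open>U\<close> show that the differences of \<open>U\<close> add up to at most 0 when each
  annihilating flip is counted once for both of its particles; the term \<open>4 n E\<close> pays for counting it
  only once. Hence the expected change per step is at most \<open>- 4\<close>, the expected convergence time is at
  most the initial value of the function, and this is \<open>O(n \<Sum>i. \<bar>h i\<bar> + n\<^sup>2)\<close>. For a uniform bridge
  distinct letters are negatively correlated, so the mean of \<open>(h i)\<^sup>2\<close> is at most \<open>n\<close>, which gives
  even \<open>O(n powr (5/2))\<close>.
\<close>

section \<open>Heights, mismatch indicators and the exclusion inequality\<close>

definition letter :: "nat list \<Rightarrow> nat \<Rightarrow> int" where
  "letter w i = (if w ! i = 1 then 1 else - 1)"

definition height :: "nat list \<Rightarrow> nat \<Rightarrow> int" where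
  "height w k = (\<Sum>j<k. letter w j)"

text \<open>Indexed by the gap left of position \<open>k\<close> and zero at both ends of the word,
  so a flip at \<open>i\<close> concerns the gaps \<open>i\<close>, \<open>Suc i\<close>,
  \<open>Suc (Suc i)\<close> without end cases.\<close>

definition mismatch_at :: "nat list \<Rightarrow> nat \<Rightarrow> int" where
  "mismatch_at w k = (if 0 < k \<and> k < length w \<and> w ! (k - 1) = w ! k then 1 else 0)"

definition potential :: "nat list \<Rightarrow> int" where
  "potential w =
     (\<Sum>i<length w. \<Sum>j<length w. \<bar>height w i - height w j\<bar>)
     + 2 * int (length w) * (\<Sum>i<length w. \<bar>height w i\<bar>)
     + 4 * int (length w) * int (mism w)"

text \<open>In the next lemma \<open>m x\<close> indicates a mismatch (particle) between the letters \<open>x - 1\<close> and \<open>x\<close>,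
  and \<open>d\<close> is the difference of \<open>U\<close> across a height. The factor \<open>m i + m (i + 2)\<close> counts an annihilating
  flip twice.\<close>

lemma flip_sum_nonpos:
  fixes a m h d :: "_ \<Rightarrow> int" and N :: nat
  assumes N: "N \<ge> 1"
    and m01: "\<And>x. m x = 0 \<or> m x = 1" and m0: "m 0 = 0" and mN: "m (Suc N) = 0"
    and m: "\<And>x. x < N \<Longrightarrow> m (Suc x) = 1 \<longleftrightarrow> a x = a (Suc x)"
    and a: "\<And>x. a x = 1 \<or> a x = - 1"
    and h: "\<And>x. h (Suc x) = h x + a x" and h0: "h 0 = 0" and hN: "h (Suc N) = 0"
    and d: "mono d" and d1: "d 1 \<ge> 0" and d1': "d (- 1) \<le> 0"
  shows "(\<Sum>i<N. (1 - m (Suc i)) * a (Suc i) * d (h i) * (m i + m (Suc (Suc i)))) \<le> 0"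
proof -
  \<comment> \<open>A particle hopping from \<open>i + 2\<close> to \<open>i\<close> contributes
    \<open>q (i + 2)\<close>, one hopping from \<open>i\<close> to \<open>i + 2\<close> contributes
    \<open>- q i\<close>. The terms \<open>r i\<close> and \<open>r' (i + 1)\<close> cancel the hops
    blocked by a particle at \<open>i + 1\<close>.\<close>
  define q where "q i = m i * a i * d (h i)" for i
  define r where "r i = m i * m (Suc i) * a i * d (h i)" for i
  define r' where "r' i = m i * m (Suc i) * a (Suc i) * d (h (Suc i))" for i
  have *: "(1 - m (Suc i)) * a (Suc i) * d (h i) * (m i + m (Suc (Suc i))) =
      (r i - r' (Suc i)) + (q (Suc (Suc i)) - q i)" if "i < N" for i
  proof -
    have A: "m (Suc i) = 0 \<Longrightarrow> a (Suc i) = - a i"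
      using m[OF that] a[of i] a[of "Suc i"] by auto
    have B: "m (Suc (Suc i)) = 1 \<Longrightarrow> a (Suc (Suc i)) = a (Suc i)"
    proof -
      assume 1: "m (Suc (Suc i)) = 1"
      have "Suc i < N" using 1 mN that by (metis Suc_lessI zero_neq_one)
      thus "a (Suc (Suc i)) = a (Suc i)" using m[of "Suc i"] 1 by simp
    qed
    have C: "h (Suc (Suc i)) = h i" if "m (Suc i) = 0"
      using A[OF that] by (simp add: h)
    show ?thesis
      using m01[of i] m01[of "Suc i"] m01[of "Suc (Suc i)"] A B C
      unfolding q_def r_def r'_def by auto
  qed
  \<comment> \<open>Convexity enters here: between two adjacent particles the height moves by
    \<open>a i\<close>, and \<open>d\<close> is monotone.\<close>
  have rr: "r i \<le> r' i" if "i < N" for i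
  proof (cases "m i = 1 \<and> m (Suc i) = 1")
    case True
    hence "a i = a (Suc i)" using m[OF that] by simp
    with True have "r i - r' i = a i * (d (h i) - d (h i + a i))"
      unfolding r_def r'_def by (simp add: h algebra_simps)
    moreover have "a i * (d (h i) - d (h i + a i)) \<le> 0"
      using a[of i] monoD[OF d, of "h i" "h i + 1"] monoD[OF d, of "h i - 1" "h i"] by auto
    ultimately show ?thesis by simp
  next
    case False
    thus ?thesis using m01[of i] m01[of "Suc i"] unfolding r_def r'_def by auto
  qed
  \<comment> \<open>The stride of two leaves four boundary terms. Those at \<open>0\<close> and
    \<open>Suc N\<close> vanish; the heights at \<open>1\<close> and \<open>N\<close> are 1 or -1,
    so the signs of \<open>d 1\<close> and \<open>d (- 1)\<close> settle the other two.\<close>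
  have tel1: "(\<Sum>i<M. q (Suc (Suc i)) - q i) = q (Suc M) + q M - q 1 - q 0" for M
    by (induction M) auto
  have tel2: "(\<Sum>i<M. r i - r' (Suc i)) = (\<Sum>i<M. r i - r' i) + r' 0 - r' M" for M
    by (induction M) auto
  have "q 0 = 0" "q (Suc N) = 0" "r' 0 = 0" "r' N = 0"
    unfolding q_def r'_def by (simp_all add: m0 mN)
  moreover have "q N \<le> 0"
  proof -
    have "h N = - a N" using h[of N] hN by simp
    thus ?thesis using a[of N] m01[of N] d1 d1' unfolding q_def by auto
  qed
  moreover have "q 1 \<ge> 0"
  proof (cases "m 1 = 1")
    case True
    hence "a 0 = a 1" using m[of 0] N by simp
    moreover have "h 1 = a 0" using h[of 0] h0 by simp
    ultimately show ?thesis using True a[of 1] d1 d1' unfolding q_def by auto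
  next
    case False
    thus ?thesis using m01[of 1] unfolding q_def by simp
  qed
  moreover have "(\<Sum>i<N. r i - r' i) \<le> 0"
    by (rule sum_nonpos) (use rr in auto)
  moreover have "(\<Sum>i<N. (1 - m (Suc i)) * a (Suc i) * d (h i) * (m i + m (Suc (Suc i))))
      = (\<Sum>i<N. r i - r' (Suc i)) + (\<Sum>i<N. q (Suc (Suc i)) - q i)"
    unfolding sum.distrib[symmetric] by (rule sum.cong) (use * in auto)
  ultimately show ?thesis unfolding tel1 tel2 by simp
qed

section \<open>Moving a single height\<close>

text \<open>Only row and column \<open>k\<close> change, whence the factor 2. The right-hand sums
  also compare \<open>f' k\<close> with the old \<open>f k\<close>, a pair absent from the new
  double sum; removing it is the source of the negative drift.\<close>

lemma sum_abs_diff_update: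
  fixes f f' :: "nat \<Rightarrow> int"
  assumes k: "k < n" and f': "\<forall>j. j \<noteq> k \<longrightarrow> f' j = f j"
  shows "(\<Sum>i<n. \<Sum>j<n. \<bar>f' i - f' j\<bar>) - (\<Sum>i<n. \<Sum>j<n. \<bar>f i - f j\<bar>) =
    2 * ((\<Sum>j<n. \<bar>f' k - f j\<bar>) - (\<Sum>j<n. \<bar>f k - f j\<bar>)) - 2 * \<bar>f' k - f k\<bar>"
proof -
  let ?R = "{..<n} - {k}"
  have split: "(\<Sum>j<n. g j) = g k + sum g ?R" for g :: "nat \<Rightarrow> int"
    using k by (simp add: sum.remove)
  have pair: "(\<Sum>i<n. \<Sum>j<n. \<bar>g i - g j\<bar>) =
      2 * (\<Sum>j\<in>?R. \<bar>g k - g j\<bar>) + (\<Sum>i\<in>?R. \<Sum>j\<in>?R. \<bar>g i - g j\<bar>)" for g :: "nat \<Rightarrow> int"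
    by (simp add: split sum.distrib abs_minus_commute[of _ "g k"])
  have "(\<Sum>j\<in>?R. \<bar>f' k - f' j\<bar>) = (\<Sum>j\<in>?R. \<bar>f' k - f j\<bar>)"
    by (rule sum.cong) (auto simp: f')
  moreover have "(\<Sum>i\<in>?R. \<Sum>j\<in>?R. \<bar>f' i - f' j\<bar>) = (\<Sum>i\<in>?R. \<Sum>j\<in>?R. \<bar>f i - f j\<bar>)"
    by (intro sum.cong) (auto simp: f')
  moreover note split[of "\<lambda>j. \<bar>f' k - f j\<bar>"] split[of "\<lambda>j. \<bar>f k - f j\<bar>"]
  ultimately show ?thesis unfolding pair by simp
qed

lemma sum_abs_update:
  fixes f f' :: "nat \<Rightarrow> int"
  assumes k: "k < n" and f': "\<forall>j. j \<noteq> k \<longrightarrow> f' j = f j"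
  shows "(\<Sum>i<n. \<bar>f' i\<bar>) - (\<Sum>i<n. \<bar>f i\<bar>) = \<bar>f' k\<bar> - \<bar>f k\<bar>"
proof -
  have "(\<Sum>j\<in>{..<n} - {k}. \<bar>f' j\<bar>) = (\<Sum>j\<in>{..<n} - {k}. \<bar>f j\<bar>)"
    by (rule sum.cong) (auto simp: f')
  thus ?thesis using k by (simp add: sum.remove[of "{..<n}" k])
qed

section \<open>Effect of a flip on letters, heights and mismatches\<close>

text \<open>Arbitrary positions are allowed because this serves both adjacent flips and the
  exchangeability of letters in a uniform configuration.\<close>

lemma swap_in_configs:
  assumes "w \<in> configs n" "i < n" "j < n"
  shows "w[i := w ! j, j := w ! i] \<in> configs n"
proof -
  have "length w = n" using assms by (simp add: configs_def)
  hence *: "mset (w[i := w ! j, j := w ! i]) = mset w"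
    using assms by (simp add: mset_swap)
  have "length (filter P (w[i := w ! j, j := w ! i])) = length (filter P w)" for P
    by (metis * mset_filter size_mset)
  moreover have "set (w[i := w ! j, j := w ! i]) = set w"
    using * by (metis set_mset_mset)
  ultimately show ?thesis using assms(1) by (simp add: configs_def)
qed

lemma flip_in_configs:
  assumes "w \<in> configs n" "Suc i < n"
  shows "flip w i \<in> configs n"
  unfolding flip_def using swap_in_configs[of w n i "Suc i"] assms by simp

lemma configs_nth:
  assumes "w \<in> configs n" "i < n"
  shows "w ! i = 1 \<or> w ! i = 2"
  using assms nth_mem[of i w] unfolding configs_def by blast

lemma letter_cases: "letter w i = 1 \<or> letter w i = - 1"
  by (simp add: letter_def)

lemma letter_eq_iff:
  assumes "w \<in> configs n" "i < n" "j < n"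
  shows "letter w i = letter w j \<longleftrightarrow> w ! i = w ! j"
  using configs_nth[OF assms(1,2)] configs_nth[OF assms(1,3)] by (auto simp: letter_def)

lemma sum_letter_list:
  assumes "set w \<subseteq> {1, 2}"
  shows "(\<Sum>j<length w. letter w j) =
    int (length (filter (\<lambda>a. a = 1) w)) - int (length (filter (\<lambda>a. a = 2) w))"
  using assms
proof (induction w rule: rev_induct)
  case (snoc x xs)
  have "(\<Sum>j<length xs. letter (xs @ [x]) j) = (\<Sum>j<length xs. letter xs j)"
    by (rule sum.cong) (auto simp: letter_def nth_append)
  moreover have "letter (xs @ [x]) (length xs) = (if x = 1 then 1 else - 1)"
    by (simp add: letter_def)
  ultimately show ?case using snoc by auto
qed simp

lemma height_length:
  assumes "w \<in> configs n"
  shows "height w n = 0"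
  using assms sum_letter_list[of w] by (auto simp: configs_def height_def)

lemma height_0 [simp]: "height w 0 = 0"
  by (simp add: height_def)

lemma height_Suc: "height w (Suc k) = height w k + letter w k"
  by (simp add: height_def)

lemma letter_flip:
  assumes "Suc i < length w"
  shows "letter (flip w i) j =
    (if j = i then letter w (Suc i) else if j = Suc i then letter w i else letter w j)"
  using assms by (auto simp: letter_def flip_def nth_list_update)

lemma height_flip:
  assumes "Suc i < length w"
  shows "height (flip w i) k =
    (if k = Suc i then height w i + letter w (Suc i) else height w k)"
proof (induction k)
  case (Suc k)
  then show ?case
    by (auto simp: height_Suc letter_flip[OF assms])
qed simp

lemma mism_eq_sum: "int (mism w) = (\<Sum>k<length w. mismatch_at w k)"
proof -
  let ?A = "{i. Suc i < length w \<and> w ! i = w ! Suc i}"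
  let ?B = "{k. k < length w \<and> 0 < k \<and> w ! (k - 1) = w ! k}"
  have "bij_betw Suc ?A ?B"
    by (rule bij_betwI[where g = "\<lambda>k. k - 1"]) auto
  hence "card ?A = card ?B" by (rule bij_betw_same_card)
  moreover have "(\<Sum>k<length w. mismatch_at w k) = int (card ?B)"
  proof -
    have "(\<Sum>k<length w. mismatch_at w k) = (\<Sum>k\<in>?B. 1)"
      by (rule sum.mono_neutral_cong_right) (auto simp: mismatch_at_def)
    thus ?thesis by simp
  qed
  ultimately show ?thesis by (simp add: mism_def)
qed

lemma mismatch_at_cases: "mismatch_at w k = 0 \<or> mismatch_at w k = 1"
  by (simp add: mismatch_at_def)

text \<open>Over two letters, replacing one letter of a pair toggles its agreement. The flip does
  this to the gap on either side, if present, while the flipped pair stays distinct.\<close>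

lemma mism_flip:
  assumes w: "w \<in> configs n" and i: "Suc i < n" and neq: "w ! i \<noteq> w ! Suc i"
  shows "int (mism (flip w i)) - int (mism w) =
    (if 0 < i then 1 - 2 * mismatch_at w i else 0)
    + (if Suc (Suc i) < n then 1 - 2 * mismatch_at w (Suc (Suc i)) else 0)"
    (is "_ = ?A + ?B")
proof -
  have len: "length w = n" "length (flip w i) = n"
    using w flip_in_configs[OF w i] by (auto simp: configs_def)
  have *: "mismatch_at (flip w i) k - mismatch_at w k =
      (if k = i then ?A else 0) + (if k = Suc (Suc i) then ?B else 0)" if "k < n" for k
  proof -
    consider "k = 0" | "k = i" "0 < k" | "k = Suc i" | "k = Suc (Suc i)"
      | "0 < k" "k - 1 \<noteq> i" "k - 1 \<noteq> Suc i" "k \<noteq> i" "k \<noteq> Suc i" "k \<noteq> Suc (Suc i)"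
      by fastforce
    then show ?thesis
    proof cases
      case 2
      then show ?thesis
        using that i neq configs_nth[OF w, of "k - 1"] configs_nth[OF w, of k]
          configs_nth[OF w, of "Suc k"]
        by (auto simp: mismatch_at_def len flip_def nth_list_update)
    next
      case 4
      then show ?thesis
        using that i neq configs_nth[OF w, of i] configs_nth[OF w, of "Suc i"]
          configs_nth[OF w, of k]
        by (auto simp: mismatch_at_def len flip_def nth_list_update)
    qed (use that i neq in \<open>auto simp: mismatch_at_def len flip_def nth_list_update\<close>)
  qed
  have "int (mism (flip w i)) - int (mism w) =
      (\<Sum>k<n. mismatch_at (flip w i) k - mismatch_at w k)"
    by (simp add: mism_eq_sum len sum_subtractf)
  also have "\<dots> = (\<Sum>k<n. (if k = i then ?A else 0) + (if k = Suc (Suc i) then ?B else 0))"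
    by (rule sum.cong) (use * in auto)
  also have "\<dots> = ?A + ?B"
    using i by (simp add: sum.distrib sum.delta)
  finally show ?thesis .
qed

text \<open>With both outer gaps present, \<open>mism\<close> changes by 2 minus twice the number of
  particles there; with one, by 1 minus twice that number. Either is nonpositive exactly when a
  particle is there. For \<open>n = 2\<close> no outer gap exists and the flip is allowed without
  particles.\<close>

lemma allowed_flips_iff:
  assumes w: "w \<in> configs n" and n: "n \<ge> 3"
  shows "i \<in> allowed_flips w \<longleftrightarrow> Suc i < n \<and> mismatch_at w (Suc i) = 0 \<and>
    (mismatch_at w i = 1 \<or> mismatch_at w (Suc (Suc i)) = 1)"
proof (cases "Suc i < n \<and> w ! i \<noteq> w ! Suc i")
  case True
  have len: "length w = n" using w by (simp add: configs_def)
  have "mismatch_at w 0 = 0" "mismatch_at w n = 0" "mismatch_at w (Suc i) = 0"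
    using True by (auto simp: mismatch_at_def len)
  moreover have "i \<in> allowed_flips w \<longleftrightarrow> int (mism (flip w i)) - int (mism w) \<le> 0"
    using True by (auto simp: allowed_flips_def len)
  moreover have "Suc (Suc i) < n \<or> Suc (Suc i) = n" using True by auto
  ultimately show ?thesis
    using True n mism_flip[OF w, of i] mismatch_at_cases[of w i] mismatch_at_cases[of w "Suc (Suc i)"]
    by (cases "i = 0") auto
next
  case False
  thus ?thesis using w by (auto simp: allowed_flips_def mismatch_at_def configs_def)
qed

lemma finite_allowed_flips: "finite (allowed_flips w)"
  by (rule finite_subset[of _ "{..<length w}"]) (auto simp: allowed_flips_def)

text \<open>If no flip is allowed, a particle must have particles in both neighbouring gaps, as
  otherwise it could hop. So all gaps are occupied and all letters agree, contradicting
  balance.\<close>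

lemma allowed_flips_nonempty:
  assumes w: "w \<in> configs n" and n: "n \<ge> 3" and E: "mism w \<noteq> 0"
  shows "allowed_flips w \<noteq> {}"
proof
  assume empty: "allowed_flips w = {}"
  have len: "length w = n" using w by (simp add: configs_def)
  have blocked: "mismatch_at w (Suc i) = 1"
    if "Suc i < n" "mismatch_at w i = 1 \<or> mismatch_at w (Suc (Suc i)) = 1" for i
    using allowed_flips_iff[OF w n, of i] that empty mismatch_at_cases[of w "Suc i"] by auto
  obtain x where x: "mismatch_at w x = 1"
  proof -
    have "\<exists>x. mismatch_at w x \<noteq> 0"
      using E mism_eq_sum[of w] by (metis int_eq_iff_numeral of_nat_eq_0_iff sum.neutral)
    thus ?thesis using that mismatch_at_cases by blast
  qed
  hence x0: "0 < x" "x < n" by (auto simp: mismatch_at_def len split: if_splits)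
  have up: "x + k < n \<Longrightarrow> mismatch_at w (x + k) = 1" for k
    by (induction k) (use x blocked in auto)
  have down: "k < x \<Longrightarrow> mismatch_at w (x - k) = 1" for k
  proof (induction k)
    case (Suc k)
    hence "Suc (Suc (x - Suc (Suc k))) = x - k" "Suc (x - Suc (Suc k)) = x - Suc k" by auto
    thus ?case using Suc blocked[of "x - Suc (Suc k)"] x0 by simp
  qed (use x in simp)
  have all: "mismatch_at w k = 1" if "0 < k" "k < n" for k
    using up[of "k - x"] down[of "x - k"] that by (cases "k \<ge> x") auto
  have "letter w k = letter w 0" if "k < n" for k
    using that
  proof (induction k)
    case (Suc k)
    have "w ! k = w ! Suc k"
      using all[of "Suc k"] Suc.prems by (simp add: mismatch_at_def split: if_splits)
    thus ?case using Suc by (simp add: letter_def)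
  qed simp
  hence "height w n = (\<Sum>j<n. letter w 0)"
    unfolding height_def by (intro sum.cong refl) (metis lessThan_iff)
  hence "height w n = int n * letter w 0" by simp
  thus False using height_length[OF w] n letter_cases[of w 0] by auto
qed

section \<open>Negative drift of the potential\<close>

lemma potential_nonneg: "potential w \<ge> 0"
  by (auto simp: potential_def intro!: add_nonneg_nonneg sum_nonneg)

lemma sum_potential_flip:
  assumes w: "w \<in> configs n" and n: "n \<ge> 3"
  shows "(\<Sum>i\<in>allowed_flips w. potential (flip w i) - potential w)
    \<le> - 4 * int (card (allowed_flips w))"
proof -
  define U where "U v = (\<Sum>j<n. \<bar>v - height w j\<bar>) + int n * \<bar>v\<bar>" for v
  \<comment> \<open>The flip at \<open>i\<close> moves the height at \<open>Suc i\<close> from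
    \<open>h i - a (Suc i)\<close> to \<open>h i + a (Suc i)\<close>, so \<open>U\<close> changes by
    \<open>a (Suc i) * d (h i)\<close>.\<close>
  define d where "d c = U (c + 1) - U (c - 1)" for c
  define a where "a = letter w"
  define h where "h = height w"
  define m where "m = mismatch_at w"
  have len: "length w = n" using w by (simp add: configs_def)
  obtain N where N: "n = Suc N" "N \<ge> 1" using n by (cases n) auto
  have d_eq: "d c = (\<Sum>j<n. \<bar>c + 1 - h j\<bar> - \<bar>c - 1 - h j\<bar>) + int n * (\<bar>c + 1\<bar> - \<bar>c - 1\<bar>)" for c
    by (simp add: d_def U_def h_def sum_subtractf algebra_simps)
  have mono: "mono d"
  proof (rule monoI)
    fix x y :: int assume "x \<le> y"
    thus "d x \<le> d y"
      unfolding d_eq by (intro add_mono sum_mono mult_left_mono) auto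
  qed
  have bnd: "(\<Sum>j<n. \<bar>c + 1 - h j\<bar> - \<bar>c - 1 - h j\<bar>) \<le> 2 * int n"
    "- 2 * int n \<le> (\<Sum>j<n. \<bar>c + 1 - h j\<bar> - \<bar>c - 1 - h j\<bar>)" for c
  proof -
    have "(\<Sum>j<n. \<bar>c + 1 - h j\<bar> - \<bar>c - 1 - h j\<bar>) \<le> (\<Sum>j<n. 2)"
      by (rule sum_mono) auto
    thus "(\<Sum>j<n. \<bar>c + 1 - h j\<bar> - \<bar>c - 1 - h j\<bar>) \<le> 2 * int n" by simp
    have "(\<Sum>j<n. - 2) \<le> (\<Sum>j<n. \<bar>c + 1 - h j\<bar> - \<bar>c - 1 - h j\<bar>)"
      by (rule sum_mono) auto
    thus "- 2 * int n \<le> (\<Sum>j<n. \<bar>c + 1 - h j\<bar> - \<bar>c - 1 - h j\<bar>)" by simp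
  qed
  \<comment> \<open>This fixes the weight \<open>n\<close> of \<open>\<bar>v\<bar>\<close> in
    \<open>U\<close>: at \<open>c = 1\<close> that term gives \<open>2 n\<close>, against at least
    \<open>- 2 n\<close> from the sum.\<close>
  have d1: "d 1 \<ge> 0" using bnd(2)[of 1] unfolding d_eq by simp
  have d1': "d (- 1) \<le> 0" using bnd(1)[of "- 1"] unfolding d_eq by simp
  have dabs: "\<bar>d c\<bar> \<le> 4 * int n" for c
  proof -
    have "int n * (\<bar>c + 1\<bar> - \<bar>c - 1\<bar>) \<le> int n * 2" by (rule mult_left_mono) auto
    moreover have "int n * (- 2) \<le> int n * (\<bar>c + 1\<bar> - \<bar>c - 1\<bar>)" by (rule mult_left_mono) auto
    ultimately show ?thesis using bnd[of c] unfolding d_eq by linarith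
  qed
  have m01: "m x = 0 \<or> m x = 1" for x unfolding m_def by (rule mismatch_at_cases)
  have a: "a x = 1 \<or> a x = - 1" for x unfolding a_def by (rule letter_cases)
  have S: "(\<Sum>i<N. (1 - m (Suc i)) * a (Suc i) * d (h i) * (m i + m (Suc (Suc i)))) \<le> 0"
  proof (rule flip_sum_nonpos[OF N(2) m01 _ _ _ a _ _ _ mono d1 d1'])
    show "m 0 = 0" "m (Suc N) = 0" by (simp_all add: m_def mismatch_at_def len N)
    show "(m (Suc x) = 1) = (a x = a (Suc x))" if "x < N" for x
      using letter_eq_iff[OF w, of x "Suc x"] that N by (simp add: m_def a_def mismatch_at_def len)
    show "h (Suc x) = h x + a x" for x by (simp add: h_def a_def height_Suc)
    show "h 0 = 0" by (simp add: h_def)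
    show "h (Suc N) = 0" using height_length[OF w] N by (simp add: h_def)
  qed
  have allowed: "i \<in> allowed_flips w \<longleftrightarrow> i < N \<and> m (Suc i) = 0 \<and> (m i = 1 \<or> m (Suc (Suc i)) = 1)" for i
    using allowed_flips_iff[OF w n] N by (simp add: m_def)
  have step: "potential (flip w i) - potential w + 4
      \<le> 2 * (a (Suc i) * d (h i) - 4 * int n * (m i * m (Suc (Suc i))))"
    if i: "i \<in> allowed_flips w" for i
  proof -
    have i': "Suc i < n" "w ! i \<noteq> w ! Suc i" and le: "mism (flip w i) \<le> mism w"
      using i by (auto simp: allowed_flips_def len)
    have lenf: "length (flip w i) = n" by (simp add: flip_def len)
    have an: "a i = - a (Suc i)"
      using letter_eq_iff[OF w, of i "Suc i"] i' a[of i] a[of "Suc i"] by (auto simp: a_def)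
    let ?h' = "height (flip w i)"
    have h'k: "?h' (Suc i) = h i + a (Suc i)"
      using i' by (simp add: height_flip len h_def a_def)
    have hk: "h (Suc i) = h i - a (Suc i)"
      using an by (simp add: h_def a_def height_Suc)
    have oth: "\<forall>j. j \<noteq> Suc i \<longrightarrow> ?h' j = h j"
      using i' by (simp add: height_flip len h_def)
    \<comment> \<open>An annihilation removes two particles; for all other flips the bound is just
      that \<open>mism\<close> does not increase.\<close>
    have E: "int (mism (flip w i)) - int (mism w) \<le> - 2 * (m i * m (Suc (Suc i)))"
    proof (cases "m i = 1 \<and> m (Suc (Suc i)) = 1")
      case True
      hence "0 < i" "Suc (Suc i) < n" by (auto simp: m_def mismatch_at_def len split: if_splits)
      thus ?thesis using mism_flip[OF w i'] True by (simp add: m_def)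
    next
      case False
      thus ?thesis using le m01[of i] m01[of "Suc (Suc i)"] by auto
    qed
    have Ud: "U (h i + a (Suc i)) - U (h i - a (Suc i)) = a (Suc i) * d (h i)"
      using a[of "Suc i"] by (auto simp: d_def)
    have area: "2 * int n * (\<Sum>j<n. \<bar>?h' j\<bar>) - 2 * int n * (\<Sum>j<n. \<bar>h j\<bar>)
        = 2 * int n * \<bar>h i + a (Suc i)\<bar> - 2 * int n * \<bar>h i - a (Suc i)\<bar>"
      using sum_abs_update[of "Suc i" n ?h' h, OF i'(1) oth]
      unfolding h'k hk by (simp only: right_diff_distrib[symmetric])
    have "potential (flip w i) - potential w =
      2 * (U (h i + a (Suc i)) - U (h i - a (Suc i))) - 2 * \<bar>2 * a (Suc i)\<bar>
      + 4 * int n * (int (mism (flip w i)) - int (mism w))"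
      using sum_abs_diff_update[of "Suc i" n ?h' h, OF i'(1) oth] area
      unfolding potential_def lenf len h'k hk U_def h_def[symmetric]
      by (simp add: algebra_simps)
    moreover have "\<bar>2 * a (Suc i)\<bar> = 2" using a[of "Suc i"] by auto
    moreover have "4 * int n * (int (mism (flip w i)) - int (mism w))
        \<le> 4 * int n * (- 2 * (m i * m (Suc (Suc i))))"
      by (rule mult_left_mono[OF E]) simp
    ultimately show ?thesis using Ud by simp
  qed
  have "(\<Sum>i\<in>allowed_flips w. potential (flip w i) - potential w + 4)
      \<le> (\<Sum>i\<in>allowed_flips w. 2 * (a (Suc i) * d (h i) - 4 * int n * (m i * m (Suc (Suc i)))))"
    by (rule sum_mono) (rule step)
  \<comment> \<open>Equality for flips with one particle. An annihilation is counted twice on the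
    right, and \<open>dabs\<close> shows that the term \<open>4 n E\<close> of the potential pays
    for this.\<close>
  also have "\<dots> \<le> (\<Sum>i\<in>allowed_flips w.
      2 * ((1 - m (Suc i)) * a (Suc i) * d (h i) * (m i + m (Suc (Suc i)))))"
  proof (rule sum_mono)
    fix i assume "i \<in> allowed_flips w"
    hence *: "m (Suc i) = 0" "m i = 1 \<or> m (Suc (Suc i)) = 1" by (auto simp: allowed)
    have "- (a (Suc i) * d (h i)) \<le> 4 * int n" using dabs[of "h i"] a[of "Suc i"] by auto
    thus "2 * (a (Suc i) * d (h i) - 4 * int n * (m i * m (Suc (Suc i))))
      \<le> 2 * ((1 - m (Suc i)) * a (Suc i) * d (h i) * (m i + m (Suc (Suc i))))"
      using * m01[of i] m01[of "Suc (Suc i)"] by (elim disjE) (simp_all add: algebra_simps)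
  qed
  also have "\<dots> = (\<Sum>i<N. 2 * ((1 - m (Suc i)) * a (Suc i) * d (h i) * (m i + m (Suc (Suc i)))))"
  proof (rule sum.mono_neutral_left)
    show "\<forall>i\<in>{..<N} - allowed_flips w.
      2 * ((1 - m (Suc i)) * a (Suc i) * d (h i) * (m i + m (Suc (Suc i)))) = 0"
    proof
      fix i assume "i \<in> {..<N} - allowed_flips w"
      hence "m (Suc i) = 1 \<or> (m i = 0 \<and> m (Suc (Suc i)) = 0)"
        using m01[of i] m01[of "Suc i"] m01[of "Suc (Suc i)"] by (auto simp: allowed)
      thus "2 * ((1 - m (Suc i)) * a (Suc i) * d (h i) * (m i + m (Suc (Suc i)))) = 0" by auto
    qed
  qed (auto simp: allowed)
  also have "\<dots> \<le> 0" using S by (simp add: sum_distrib_left[symmetric])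
  finally show ?thesis by (simp add: sum.distrib)
qed

section \<open>From drift to expected convergence time\<close>

text \<open>The drift -4 is weakened to -1, and the indicator is added on the left to avoid
  subtraction in \<open>ennreal\<close>. Once \<open>mism w = 0\<close> the chain rests and the
  indicator vanishes.\<close>

lemma nn_integral_cool_step:
  assumes w: "w \<in> configs n" and n: "n \<ge> 3"
  shows "(\<integral>\<^sup>+ y. ennreal (potential y) \<partial>cool_step w) + indicator {y. mism y \<noteq> 0} w
    \<le> ennreal (potential w)"
proof (cases "mism w = 0")
  case True
  thus ?thesis by (simp add: cool_step_def)
next
  case False
  let ?A = "allowed_flips w"
  have ne: "?A \<noteq> {}" by (rule allowed_flips_nonempty[OF w n False])
  have c: "card ?A > 0" using ne finite_allowed_flips by (simp add: card_gt_0_iff)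
  have "(\<Sum>i\<in>?A. potential (flip w i)) + int (card ?A) \<le> int (card ?A) * potential w"
    using sum_potential_flip[OF w n] by (simp add: sum_subtractf)
  hence "real_of_int ((\<Sum>i\<in>?A. potential (flip w i)) + int (card ?A))
      \<le> real_of_int (int (card ?A) * potential w)" by (simp only: of_int_le_iff)
  hence *: "(\<Sum>i\<in>?A. real_of_int (potential (flip w i))) / card ?A + 1 \<le> potential w"
    using c by (simp add: field_simps)
  have "(\<integral>\<^sup>+ y. ennreal (potential y) \<partial>cool_step w)
      = (\<Sum>i\<in>?A. ennreal (potential (flip w i))) / card ?A"
    using False ne finite_allowed_flips[of w] by (simp add: cool_step_def nn_integral_pmf_of_set)
  also have "\<dots> = ennreal ((\<Sum>i\<in>?A. real_of_int (potential (flip w i))) / card ?A)"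
    using c potential_nonneg
    by (simp add: sum_ennreal ennreal_of_nat_eq_real_of_nat divide_ennreal sum_nonneg)
  finally have "(\<integral>\<^sup>+ y. ennreal (potential y) \<partial>cool_step w) + indicator {y. mism y \<noteq> 0} w
      = ennreal ((\<Sum>i\<in>?A. real_of_int (potential (flip w i))) / card ?A + 1)"
    using False potential_nonneg by (simp add: ennreal_plus sum_nonneg)
  also have "\<dots> \<le> ennreal (potential w)" using * by (rule ennreal_leI)
  finally show ?thesis .
qed

lemma set_pmf_cool_step:
  assumes w: "w \<in> configs n" and n: "n \<ge> 3"
  shows "set_pmf (cool_step w) \<subseteq> configs n"
proof (cases "mism w = 0")
  case False
  have "length w = n" using w by (simp add: configs_def)
  thus ?thesis
    using False allowed_flips_nonempty[OF w n False] finite_allowed_flips[of w] flip_in_configs[OF w]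
    by (auto simp: cool_step_def allowed_flips_def)
qed (use w in \<open>simp add: cool_step_def\<close>)

text \<open>The law of the state at time \<open>t\<close> alone; \<open>cool_at_Suc\<close> is its
  Markov recursion.\<close>

definition cool_at :: "nat \<Rightarrow> nat list \<Rightarrow> nat list pmf" where
  "cool_at t w = map_pmf last (cool_traj t w)"

lemma cool_at_0: "cool_at 0 w = return_pmf w"
  by (simp add: cool_at_def)

lemma cool_at_Suc: "cool_at (Suc t) w = bind_pmf (cool_at t w) cool_step"
  by (simp add: cool_at_def map_bind_pmf bind_map_pmf map_pmf_comp)

lemma set_pmf_cool_at:
  assumes "w \<in> configs n" "n \<ge> 3"
  shows "set_pmf (cool_at t w) \<subseteq> configs n"
  by (induction t) (use assms set_pmf_cool_step in \<open>fastforce simp: cool_at_0 cool_at_Suc\<close>)+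

lemma cool_traj_nonempty: "xs \<in> set_pmf (cool_traj t w) \<Longrightarrow> xs \<noteq> []"
  by (cases t) auto

text \<open>The mean potential \<open>J t\<close> drops at each step by at least the probability
  \<open>p t\<close> of still having mismatches. Telescoping bounds every partial sum of
  \<open>p\<close> by \<open>J 0\<close>.\<close>

lemma exp_conv_time_le:
  assumes w: "w \<in> configs n" and n: "n \<ge> 3"
  shows "exp_conv_time w \<le> ennreal (potential w)"
proof -
  let ?B = "{y. mism y \<noteq> 0}"
  define J where "J t = (\<integral>\<^sup>+ y. ennreal (potential y) \<partial>cool_at t w)" for t
  define p where "p t = emeasure (cool_at t w) ?B" for t
  have J: "J (Suc t) + p t \<le> J t" for t
  proof -
    have "J (Suc t) + p t = (\<integral>\<^sup>+ y. (\<integral>\<^sup>+ z. ennreal (potential z) \<partial>cool_step y)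
        + indicator ?B y \<partial>cool_at t w)"
      by (simp add: J_def p_def cool_at_Suc nn_integral_add)
    also have "\<dots> \<le> J t"
      unfolding J_def
      by (rule nn_integral_mono_AE)
        (use set_pmf_cool_at[OF w n] nn_integral_cool_step[OF _ n] in \<open>auto simp: AE_measure_pmf_iff\<close>)
    finally show ?thesis .
  qed
  have sum: "(\<Sum>t<k. p t) + J k \<le> ennreal (potential w)" for k
  proof (induction k)
    case 0
    show ?case by (simp add: J_def cool_at_0)
  next
    case (Suc k)
    have "(\<Sum>t<Suc k. p t) + J (Suc k) = (\<Sum>t<k. p t) + (J (Suc k) + p k)"
      by (simp add: ac_simps)
    also have "\<dots> \<le> (\<Sum>t<k. p t) + J k" by (intro add_left_mono J)
    finally show ?case using Suc by (rule order_trans)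
  qed
  \<comment> \<open>If all states up to time \<open>t\<close> have mismatches, so does the last one;
    trajectories are nonempty, so \<open>last\<close> is one of their entries.\<close>
  have pt: "ennreal (measure_pmf.prob (cool_traj t w) {xs. \<forall>x\<in>set xs. mism x \<noteq> 0}) \<le> p t" for t
  proof -
    have "emeasure (cool_traj t w) {xs. \<forall>x\<in>set xs. mism x \<noteq> 0}
        \<le> emeasure (cool_traj t w) (last -` ?B)"
      by (rule emeasure_mono_AE) (auto simp: AE_measure_pmf_iff dest: cool_traj_nonempty)
    thus ?thesis by (simp add: p_def cool_at_def measure_pmf.emeasure_eq_measure)
  qed
  have "exp_conv_time w \<le> (\<Sum>t. p t)"
    unfolding exp_conv_time_def by (intro suminf_le pt) auto
  also have "\<dots> \<le> ennreal (potential w)"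
  proof (rule suminf_le_const)
    fix k
    show "(\<Sum>t<k. p t) \<le> ennreal (potential w)"
      using sum[of k] by (metis add_increasing2 le_iff_add order_trans zero_le)
  qed simp
  finally show ?thesis .
qed

section \<open>Averages over uniform configurations\<close>

lemma finite_configs: "finite (configs n)"
  by (rule finite_subset[OF _ finite_lists_length_eq[of "{1, 2}" n]]) (auto simp: configs_def)

text \<open>Exchangeability: swapping positions \<open>j\<close> and \<open>k\<close> is an
  involution of \<open>configs n\<close>.\<close>

lemma sum_letter_product_swap:
  assumes "i < n" "j < n" "k < n" "i \<noteq> j" "i \<noteq> k"
  shows "(\<Sum>w\<in>configs n. letter w i * letter w j) = (\<Sum>w\<in>configs n. letter w i * letter w k)"
proof -
  let ?s = "\<lambda>w :: nat list. w[j := w ! k, k := w ! j]"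
  have len: "length w = n" if "w \<in> configs n" for w using that by (simp add: configs_def)
  have inv: "?s (?s w) = w" if "w \<in> configs n" for w
    using assms len[OF that] by (auto intro!: nth_equalityI simp: nth_list_update)
  have "bij_betw ?s (configs n) (configs n)"
    by (rule bij_betwI[where g = ?s]) (use inv swap_in_configs assms in auto)
  hence "(\<Sum>w\<in>configs n. letter w i * letter w j) = (\<Sum>w\<in>configs n. letter (?s w) i * letter (?s w) j)"
    by (rule sum.reindex_bij_betw[symmetric])
  also have "\<dots> = (\<Sum>w\<in>configs n. letter w i * letter w k)"
    by (rule sum.cong) (use assms len in \<open>auto simp: letter_def nth_list_update\<close>)
  finally show ?thesis .
qed

lemma letter_square [simp]: "letter w i * letter w i = 1"
  by (simp add: letter_def)

text \<open>For fixed \<open>i\<close> the sums \<open>c k\<close> add up to 0 over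
  \<open>k\<close>, since each configuration has total height 0. Here \<open>c i \<ge> 0\<close> and
  the others are equal, hence nonpositive.\<close>

lemma sum_letter_product_nonpos:
  assumes ij: "i < n" "j < n" "i \<noteq> j"
  shows "(\<Sum>w\<in>configs n. letter w i * letter w j) \<le> 0"
proof -
  define c where "c k = (\<Sum>w\<in>configs n. letter w i * letter w k)" for k
  have "(\<Sum>k<n. c k) = (\<Sum>w\<in>configs n. letter w i * height w n)"
    unfolding c_def height_def sum_distrib_left by (rule sum.swap)
  also have "\<dots> = 0" by (rule sum.neutral) (simp add: height_length)
  finally have "(\<Sum>k<n. c k) = 0" .
  moreover have "(\<Sum>k<n. c k) = c i + (\<Sum>k\<in>{..<n} - {i}. c k)"
    using ij by (simp add: sum.remove)
  moreover have "(\<Sum>k\<in>{..<n} - {i}. c k) = (\<Sum>k\<in>{..<n} - {i}. c j)"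
    unfolding c_def by (intro sum.cong refl sum_letter_product_swap) (use ij in auto)
  moreover have "c i \<ge> 0" by (simp add: c_def)
  ultimately have "int (card ({..<n} - {i})) * c j \<le> 0" by simp
  moreover have "int (card ({..<n} - {i})) > 0" using ij by simp
  ultimately have "c j \<le> 0" by (metis mult_pos_pos not_less)
  thus ?thesis by (simp add: c_def)
qed

lemma sum_height_square_le:
  assumes "k \<le> n"
  shows "(\<Sum>w\<in>configs n. (height w k)\<^sup>2) \<le> int k * int (card (configs n))"
proof -
  have "(\<Sum>w\<in>configs n. (height w k)\<^sup>2) =
      (\<Sum>w\<in>configs n. \<Sum>i<k. \<Sum>j<k. letter w i * letter w j)"
    by (simp add: height_def power2_eq_square sum_product)
  also have "\<dots> = (\<Sum>i<k. \<Sum>w\<in>configs n. \<Sum>j<k. letter w i * letter w j)"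
    by (rule sum.swap)
  also have "\<dots> = (\<Sum>i<k. \<Sum>j<k. \<Sum>w\<in>configs n. letter w i * letter w j)"
    by (rule sum.cong[OF refl]) (rule sum.swap)
  also have "\<dots> \<le> (\<Sum>i<k. \<Sum>j<k. if i = j then int (card (configs n)) else 0)"
    using assms by (intro sum_mono) (auto simp: sum_letter_product_nonpos)
  also have "\<dots> = int k * int (card (configs n))" by simp
  finally show ?thesis .
qed

lemma sum_abs_height_le:
  assumes "k \<le> n" "n > 0"
  shows "(\<Sum>w\<in>configs n. \<bar>real_of_int (height w k)\<bar>) \<le> sqrt n * card (configs n)"
proof -
  \<comment> \<open>Plays the part of Cauchy-Schwarz: the scale \<open>sqrt n\<close> balances both
    terms when the second moment is at most \<open>n\<close>.\<close>
  have amgm: "\<bar>x\<bar> \<le> (x\<^sup>2 / sqrt n + sqrt n) / 2" for x :: real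
  proof -
    have "0 \<le> (\<bar>x\<bar> - sqrt n)\<^sup>2" by simp
    hence "2 * (\<bar>x\<bar> * sqrt n) \<le> x\<^sup>2 + sqrt n * sqrt n"
      by (simp add: power2_eq_square algebra_simps)
    thus ?thesis using assms(2) by (simp add: field_simps)
  qed
  have "real_of_int (\<Sum>w\<in>configs n. (height w k)\<^sup>2) \<le> real_of_int (int k * int (card (configs n)))"
    using sum_height_square_le[OF assms(1)] by (simp only: of_int_le_iff)
  also have "\<dots> \<le> real n * card (configs n)" using assms by (simp add: mult_right_mono)
  finally have sq: "(\<Sum>w\<in>configs n. (real_of_int (height w k))\<^sup>2) \<le> real n * card (configs n)"
    by simp
  have "(\<Sum>w\<in>configs n. \<bar>real_of_int (height w k)\<bar>)
      \<le> (\<Sum>w\<in>configs n. ((real_of_int (height w k))\<^sup>2 / sqrt n + sqrt n) / 2)"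
    by (rule sum_mono) (rule amgm)
  also have "\<dots> = ((\<Sum>w\<in>configs n. (real_of_int (height w k))\<^sup>2) / sqrt n
      + card (configs n) * sqrt n) / 2"
    by (simp add: sum.distrib sum_divide_distrib[symmetric])
  also have "\<dots> \<le> ((real n * card (configs n)) / sqrt n + card (configs n) * sqrt n) / 2"
    using sq by (intro divide_right_mono add_right_mono) auto
  also have "\<dots> = ((real n / sqrt n) * card (configs n) + card (configs n) * sqrt n) / 2"
    by simp
  also have "\<dots> = sqrt n * card (configs n)" by (simp add: real_div_sqrt)
  finally show ?thesis .
qed

lemma potential_le:
  assumes "length w = n"
  shows "potential w \<le> 4 * int n * (\<Sum>i<n. \<bar>height w i\<bar>) + 4 * int n * int n"
proof -
  have "(\<Sum>i<n. \<Sum>j<n. \<bar>height w i - height w j\<bar>)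
      \<le> (\<Sum>i<n. \<Sum>j<n. \<bar>height w i\<bar> + \<bar>height w j\<bar>)"
    by (intro sum_mono abs_triangle_ineq4)
  also have "\<dots> = 2 * int n * (\<Sum>i<n. \<bar>height w i\<bar>)"
    by (simp add: sum.distrib sum_distrib_left mult.assoc)
  finally have "(\<Sum>i<n. \<Sum>j<n. \<bar>height w i - height w j\<bar>) \<le> 2 * int n * (\<Sum>i<n. \<bar>height w i\<bar>)" .
  moreover have "mism w \<le> n"
  proof -
    have "mism w \<le> card {..<n}"
      unfolding mism_def using assms by (intro card_mono) auto
    thus ?thesis by simp
  qed
  hence "int n * int (mism w) \<le> int n * int n" by (intro mult_left_mono) auto
  ultimately show ?thesis unfolding potential_def assms by linarith
qed

lemma sum_potential_le:
  assumes n: "n > 0"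
  shows "(\<Sum>w\<in>configs n. real_of_int (potential w)) \<le> 8 * real n powr (5/2) * card (configs n)"
proof -
  let ?c = "real (card (configs n))"
  have "(\<Sum>w\<in>configs n. real_of_int (potential w))
      \<le> (\<Sum>w\<in>configs n. 4 * real n * (\<Sum>i<n. \<bar>real_of_int (height w i)\<bar>) + 4 * real n * real n)"
  proof (rule sum_mono)
    fix w assume "w \<in> configs n"
    hence "length w = n" by (simp add: configs_def)
    hence "real_of_int (potential w)
        \<le> real_of_int (4 * int n * (\<Sum>i<n. \<bar>height w i\<bar>) + 4 * int n * int n)"
      using potential_le by (simp only: of_int_le_iff)
    thus "real_of_int (potential w)
        \<le> 4 * real n * (\<Sum>i<n. \<bar>real_of_int (height w i)\<bar>) + 4 * real n * real n" by simp
  qed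
  also have "\<dots> = 4 * real n * (\<Sum>i<n. \<Sum>w\<in>configs n. \<bar>real_of_int (height w i)\<bar>)
      + ?c * (4 * real n * real n)"
    unfolding sum.distrib sum_distrib_left[symmetric]
    by (subst sum.swap) simp
  also have "\<dots> \<le> 4 * real n * (\<Sum>i<n. sqrt n * ?c) + ?c * (4 * real n * real n)"
    using n by (intro add_right_mono mult_left_mono sum_mono sum_abs_height_le) auto
  also have "\<dots> = 4 * (real n * real n * sqrt n) * ?c + 4 * (real n * real n * 1) * ?c"
    by simp
  \<comment> \<open>The quadratic term is absorbed using \<open>sqrt n \<ge> 1\<close>, which gives
    the constant 8 = 4 + 4.\<close>
  also have "\<dots> \<le> 4 * (real n * real n * sqrt n) * ?c + 4 * (real n * real n * sqrt n) * ?c"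
    using n by (intro add_left_mono mult_right_mono mult_left_mono) auto
  also have "real n * real n * sqrt n = real n powr (5/2)"
  proof -
    have "real n powr (5/2) = real n powr (2 + 1/2)" by simp
    also have "\<dots> = real n powr 2 * real n powr (1/2)" by (rule powr_add)
    also have "\<dots> = real n * real n * sqrt n"
      using n by (simp add: powr_half_sqrt power2_eq_square)
    finally show ?thesis by simp
  qed
  finally show ?thesis by (simp add: mult_ac)
qed

theorem theorem2:
  "\<exists>C::real. \<exists>N::nat. \<forall>n\<ge>N.
     T_unif n \<le> ennreal (C * real n powr (5/2) * ln (real n))"
proof (intro exI allI impI)
  \<comment> \<open>The threshold 3 suits the description of allowed flips and exceeds
    \<open>exp 1\<close>, so the logarithm is at least 1.\<close>
  fix n :: nat assume n: "n \<ge> 3"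
  show "T_unif n \<le> ennreal (8 * real n powr (5/2) * ln (real n))"
  proof (cases "configs n = {}")
    \<comment> \<open>This happens for odd \<open>n\<close>; then \<open>T_unif n\<close> is
      \<open>0 / 0\<close>, which is 0 in \<open>ennreal\<close>.\<close>
    case True
    thus ?thesis by (simp add: T_unif_def)
  next
    case False
    hence c: "card (configs n) > 0" using finite_configs by (simp add: card_gt_0_iff)
    have "exp 1 \<le> real n" using exp_le n by linarith
    hence ln: "ln (real n) \<ge> 1" using n by (simp add: ln_ge_iff)
    have "(\<Sum>w\<in>configs n. exp_conv_time w) \<le> (\<Sum>w\<in>configs n. ennreal (potential w))"
      using n by (intro sum_mono exp_conv_time_le)
    also have "\<dots> = ennreal (\<Sum>w\<in>configs n. real_of_int (potential w))"
      by (rule sum_ennreal) (simp add: potential_nonneg)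
    also have "\<dots> \<le> ennreal (8 * real n powr (5/2) * card (configs n))"
      using n by (intro ennreal_leI sum_potential_le) auto
    finally have "T_unif n \<le> ennreal (8 * real n powr (5/2) * card (configs n)) / of_nat (card (configs n))"
      unfolding T_unif_def by (rule divide_right_mono_ennreal)
    also have "\<dots> = ennreal (8 * real n powr (5/2))"
      using c by (simp add: ennreal_of_nat_eq_real_of_nat divide_ennreal)
    also have "\<dots> \<le> ennreal (8 * real n powr (5/2) * ln (real n))"
      using ln by (intro ennreal_leI mult_le_cancel_left1[THEN iffD2]) auto
    finally show ?thesis .
  qed
qed

end
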